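(* Let $(X,\|\cdot\|)$ be a real Banach space ordered by a norm-closed cone $K$, and let $d$ be the Thompson metric on $K$. The following assertions are equivalent. 1. The Thompson metric $d$ is complete on $K$ (equivalently, each component of $K$ is $d$-complete). 2. The cone $K$ is self-complete. 3. The cone $K$ is normal. 4. The norm topology on $K$ is weaker (coarser) than the topology of $d$ on $K$.
   Context: A cone $K$ in a real vector space $X$ is a nonempty subset with $K+K\subset K$, $tK\subset K$ for all $t\ge 0$, and $K\cap(-K)=\{0\}$; it induces the order $x\le y\iff y-x\in K$. Two elements $x,y\in K$ are linked ($x\sim y$) if there are $\lambda,\mu>0$ with $x\le\lambda y$ and $y\le\mu x$; this is an equivalence relation on $K$ whose classes are called components. The Thompson metric is $d(x,y)=\inf\{s\ge 0: e^{-s}x\le y\le e^{s}x\}$ for $x,y\in K$, with $\inf\emptyset=\infty$. It is an extended semimetric on $K$, finite exactly on linked pairs; its topology is defined by balls, and Cauchy sequences and completeness are defined as usual. A sequence $(x_n)$ in $K$ is upper self-bounded if for every $\lambda>1$ there is $k\in\mathbb{N}$ with $x_n\le\lambda x_k$ for all $n\ge k$; lower self-bounded if for every $\mu\in(0,1)$ there is $k\in\mathbb{N}$ with $x_n\ge\mu x_k$ for all $n\ge k$; self-bounded if both. A nonempty $U\subset K$ is upper self-complete if every increasing self-bounded sequence $(x_n)$ in $U$ has a supremum (in $X$) and $\sup_n x_n\in U$; lower self-complete if every decreasing self-bounded sequence in $U$ has an infimum (in $X$) belonging to $U$; self-complete if both. A subset $A$ of $X$ is order-convex if $\{z: x\le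 z\le y\}\subset A$ for all $x,y\in A$. The cone $K$ is normal if $0$ has a neighborhood basis consisting of order-convex sets. *)

theory Defs
  imports "HOL-Analysis.Analysis"
begin

definition ordering_cone :: "'a::real_vector set \<Rightarrow> bool" where
  "ordering_cone K \<longleftrightarrow>
     K \<noteq> {} \<and> (\<forall>x\<in>K. \<forall>y\<in>K. x + y \<in> K) \<and> cone K \<and>
     K \<inter> uminus ` K = {0}"

definition cone_le :: "'a::real_vector set \<Rightarrow> 'a \<Rightarrow> 'a \<Rightarrow> bool" where
  "cone_le K x y \<longleftrightarrow> y - x \<in> K"

definition linked :: "'a::real_vector set \<Rightarrow> ('a \<times> 'a) set" where
  "linked K = {(x, y). x \<in> K \<and> y \<in> K \<and>
     (\<exists>a>0. \<exists>b>0. cone_le K x (a *\<^sub>R y) \<and> cone_le K y (b *\<^sub>R x))}"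

definition components_of_cone :: "'a::real_vector set \<Rightarrow> 'a set set" where
  "components_of_cone K = K // linked K"

text \<open>The infimum is taken in the extended reals, so it is \<open>\<infinity>\<close> when no \<open>s\<close> is admissible.\<close>

definition thompson :: "'a::real_vector set \<Rightarrow> 'a \<Rightarrow> 'a \<Rightarrow> ereal" where
  "thompson K x y =
     Inf (ereal ` {s. s \<ge> 0 \<and> cone_le K (exp (- s) *\<^sub>R x) y \<and> cone_le K y (exp s *\<^sub>R x)})"

definition thompson_ball :: "'a::real_vector set \<Rightarrow> 'a \<Rightarrow> real \<Rightarrow> 'a set" where
  "thompson_ball K x r = {y \<in> K. thompson K x y < ereal r}"

definition thompson_topology :: "'a::real_vector set \<Rightarrow> 'a topology" where
  "thompson_topology K =
     topology (\<lambda>U. U \<subseteq> K \<and> (\<forall>x\<in>U. \<exists>r>0. thompson_ball K x r \<subseteq> U))"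

lemma openin_thompson_topology:
  "openin (thompson_topology K) U \<longleftrightarrow>
     U \<subseteq> K \<and> (\<forall>x\<in>U. \<exists>r>0. thompson_ball K x r \<subseteq> U)"
proof -
  have "istopology (\<lambda>U. U \<subseteq> K \<and> (\<forall>x\<in>U. \<exists>r>0. thompson_ball K x r \<subseteq> U))"
    unfolding istopology_def
  proof (intro conjI allI impI)
    fix S T
    assume S: "S \<subseteq> K \<and> (\<forall>x\<in>S. \<exists>r>0. thompson_ball K x r \<subseteq> S)"
      and T: "T \<subseteq> K \<and> (\<forall>x\<in>T. \<exists>r>0. thompson_ball K x r \<subseteq> T)"
    show "S \<inter> T \<subseteq> K" using S by blast
    show "\<forall>x\<in>S \<inter> T. \<exists>r>0. thompson_ball K x r \<subseteq> S \<inter> T"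
    proof
      fix x assume "x \<in> S \<inter> T"
      then obtain r s where "r > 0" "thompson_ball K x r \<subseteq> S" "s > 0" "thompson_ball K x s \<subseteq> T"
        using S T by blast
      moreover have "thompson_ball K x (min r s) \<subseteq> thompson_ball K x r \<inter> thompson_ball K x s"
        by (auto simp: thompson_ball_def intro: order.strict_trans2[where b = "ereal (min r s)"])
      ultimately have "min r s > 0 \<and> thompson_ball K x (min r s) \<subseteq> S \<inter> T"
        by auto
      then show "\<exists>r>0. thompson_ball K x r \<subseteq> S \<inter> T"
        by blast
    qed
  next
    fix \<K>
    assume *: "\<forall>S\<in>\<K>. S \<subseteq> K \<and> (\<forall>x\<in>S. \<exists>r>0. thompson_ball K x r \<subseteq> S)"
    then show "\<Union>\<K> \<subseteq> K" by blast
    show "\<forall>x\<in>\<Union>\<K>. \<exists>r>0. thompson_ball K x r \<subseteq> \<Union>\<K>"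
      using * by (meson Union_iff Union_upper subset_trans)
  qed
  then show ?thesis
    by (simp add: thompson_topology_def topology_inverse')
qed

lemma topspace_thompson_topology [simp]: "topspace (thompson_topology K) = K"
proof -
  have "openin (thompson_topology K) K"
    using gt_ex[of "0::real"] by (auto simp: openin_thompson_topology thompson_ball_def)
  moreover have "topspace (thompson_topology K) \<subseteq> K"
    using openin_topspace[of "thompson_topology K"] by (simp only: openin_thompson_topology)
  ultimately show ?thesis
    by (intro subset_antisym openin_subset)
qed

definition thompson_Cauchy :: "'a::real_vector set \<Rightarrow> (nat \<Rightarrow> 'a) \<Rightarrow> bool" where
  "thompson_Cauchy K x \<longleftrightarrow>
     (\<forall>e::real>0. \<exists>N. \<forall>m\<ge>N. \<forall>n\<ge>N. thompson K (x m) (x n) < ereal e)"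

definition thompson_complete :: "'a::real_vector set \<Rightarrow> 'a set \<Rightarrow> bool" where
  "thompson_complete K A \<longleftrightarrow>
     (\<forall>x. range x \<subseteq> A \<and> thompson_Cauchy K x \<longrightarrow>
        (\<exists>l\<in>A. (\<lambda>n. thompson K (x n) l) \<longlonglongrightarrow> 0))"

definition upper_self_bounded :: "'a::real_vector set \<Rightarrow> (nat \<Rightarrow> 'a) \<Rightarrow> bool" where
  "upper_self_bounded K x \<longleftrightarrow> (\<forall>c>1. \<exists>k. \<forall>n\<ge>k. cone_le K (x n) (c *\<^sub>R x k))"

definition lower_self_bounded :: "'a::real_vector set \<Rightarrow> (nat \<Rightarrow> 'a) \<Rightarrow> bool" where
  "lower_self_bounded K x \<longleftrightarrow> (\<forall>c. 0 < c \<and> c < 1 \<longrightarrow> (\<exists>k. \<forall>n\<ge>k. cone_le K (c *\<^sub>R x k) (x n)))"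

definition self_bounded :: "'a::real_vector set \<Rightarrow> (nat \<Rightarrow> 'a) \<Rightarrow> bool" where
  "self_bounded K x \<longleftrightarrow> upper_self_bounded K x \<and> lower_self_bounded K x"

text \<open>
  Suprema and infima are those of the ordered space \<open>X\<close>: the competing bounds \<open>u\<close> below range
  over the whole type. They are unique, since the order induced by a cone is antisymmetric.
\<close>

definition is_cone_sup :: "'a::real_vector set \<Rightarrow> 'a set \<Rightarrow> 'a \<Rightarrow> bool" where
  "is_cone_sup K A s \<longleftrightarrow>
     (\<forall>a\<in>A. cone_le K a s) \<and> (\<forall>u. (\<forall>a\<in>A. cone_le K a u) \<longrightarrow> cone_le K s u)"

definition is_cone_inf :: "'a::real_vector set \<Rightarrow> 'a set \<Rightarrow> 'a \<Rightarrow> bool" where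
  "is_cone_inf K A s \<longleftrightarrow>
     (\<forall>a\<in>A. cone_le K s a) \<and> (\<forall>u. (\<forall>a\<in>A. cone_le K u a) \<longrightarrow> cone_le K u s)"

definition upper_self_complete :: "'a::real_vector set \<Rightarrow> 'a set \<Rightarrow> bool" where
  "upper_self_complete K U \<longleftrightarrow> U \<noteq> {} \<and> U \<subseteq> K \<and>
     (\<forall>x. range x \<subseteq> U \<and> monotone (\<le>) (cone_le K) x \<and> self_bounded K x \<longrightarrow>
        (\<exists>s\<in>U. is_cone_sup K (range x) s))"

definition lower_self_complete :: "'a::real_vector set \<Rightarrow> 'a set \<Rightarrow> bool" where
  "lower_self_complete K U \<longleftrightarrow> U \<noteq> {} \<and> U \<subseteq> K \<and>
     (\<forall>x. range x \<subseteq> U \<and> monotone (\<le>) (\<lambda>a b. cone_le K b a) x \<and> self_bounded K x \<longrightarrow>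
        (\<exists>s\<in>U. is_cone_inf K (range x) s))"

definition self_complete :: "'a::real_vector set \<Rightarrow> 'a set \<Rightarrow> bool" where
  "self_complete K U \<longleftrightarrow> upper_self_complete K U \<and> lower_self_complete K U"

definition order_convex :: "'a::real_vector set \<Rightarrow> 'a set \<Rightarrow> bool" where
  "order_convex K A \<longleftrightarrow> (\<forall>x\<in>A. \<forall>y\<in>A. {z. cone_le K x z \<and> cone_le K z y} \<subseteq> A)"

definition normal_cone :: "'a::real_normed_vector set \<Rightarrow> bool" where
  "normal_cone K \<longleftrightarrow>
     (\<exists>\<B>. (\<forall>N\<in>\<B>. 0 \<in> interior N \<and> order_convex K N) \<and>
          (\<forall>V. 0 \<in> interior V \<longrightarrow> (\<exists>N\<in>\<B>. N \<subseteq> V)))"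

end

theory Submission
  imports Defs
begin

text \<open>
  Normality amounts to norm boundedness of every order interval \<open>[0, u]\<close>: if
  \<open>0 \<le> y\<^sub>n \<le> x\<^sub>n\<close> violates every norm estimate, rescale so that \<open>\<Sum>x\<^sub>n\<close> converges to some
  \<open>u\<close>; then the \<open>y\<^sub>n\<close> are unbounded in \<open>[0, u]\<close>. For a self-complete cone, the ideal generated
  by \<open>u\<close> is complete in its order-unit norm, since a rapidly Cauchy sequence becomes increasing
  and self-bounded after adding suitable multiples of \<open>u\<close>. The inclusion of this ideal into
  \<open>X\<close> has closed graph because \<open>K\<close> is closed, so it is bounded, by the Baire category argument
  of the closed graph theorem. If the Thompson topology is finer, then \<open>u + ty\<close> with
  \<open>0 \<le> y \<le> u\<close> stays in the unit norm ball about \<open>u\<close> for one \<open>t > 0\<close>, which again bounds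
  \<open>[0, u]\<close>. Conversely, in a normal cone a Thompson Cauchy sequence is norm Cauchy, and its norm
  limit is also the Thompson limit.
\<close>

locale closed_cone =
  fixes K :: "'a::banach set"
  assumes ordering_cone: "ordering_cone K" and closed_K: "closed K"
begin

abbreviation le :: "'a \<Rightarrow> 'a \<Rightarrow> bool" (infix "\<preceq>" 50) where
  "x \<preceq> y \<equiv> cone_le K x y"

section \<open>Order arithmetic in a closed cone\<close>

lemma add_mem: "x \<in> K \<Longrightarrow> y \<in> K \<Longrightarrow> x + y \<in> K"
  using ordering_cone by (auto simp: ordering_cone_def)

lemma scale_mem: "x \<in> K \<Longrightarrow> 0 \<le> a \<Longrightarrow> a *\<^sub>R x \<in> K"
  using ordering_cone by (auto simp: ordering_cone_def cone_def)

lemma zero_mem: "0 \<in> K"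
  using ordering_cone by (auto simp: ordering_cone_def)

lemma mem_antisym: "x \<in> K \<Longrightarrow> - x \<in> K \<Longrightarrow> x = 0"
proof -
  assume "x \<in> K" "- x \<in> K"
  then have "x \<in> K \<inter> uminus ` K"
    by (metis IntI image_eqI minus_minus)
  then show "x = 0"
    using ordering_cone by (auto simp: ordering_cone_def)
qed

lemma le_zero_iff: "0 \<preceq> x \<longleftrightarrow> x \<in> K"
  by (simp add: cone_le_def)

lemma le_refl: "x \<preceq> x"
  by (simp add: cone_le_def zero_mem)

lemma le_trans [trans]: "x \<preceq> y \<Longrightarrow> y \<preceq> z \<Longrightarrow> x \<preceq> z"
  unfolding cone_le_def using add_mem[of "y - x" "z - y"] by simp

lemma le_antisym: "x \<preceq> y \<Longrightarrow> y \<preceq> x \<Longrightarrow> x = y"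
  unfolding cone_le_def using mem_antisym[of "y - x"] by simp

lemma le_add: "x \<preceq> y \<Longrightarrow> z \<preceq> w \<Longrightarrow> x + z \<preceq> y + w"
  unfolding cone_le_def using add_mem[of "y - x" "w - z"] by (simp add: algebra_simps)

lemma le_scale: "x \<preceq> y \<Longrightarrow> 0 \<le> a \<Longrightarrow> a *\<^sub>R x \<preceq> a *\<^sub>R y"
  unfolding cone_le_def using scale_mem[of "y - x" a] by (simp add: algebra_simps)

lemma le_scale_left: "x \<in> K \<Longrightarrow> a \<le> b \<Longrightarrow> a *\<^sub>R x \<preceq> b *\<^sub>R x"
  unfolding cone_le_def using scale_mem[of x "b - a"] by (simp add: algebra_simps)

text \<open>Closedness of \<open>K\<close> lets the order pass to limits, because the differences
  \<open>g i - f i\<close> stay in \<open>K\<close>.\<close>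

lemma le_limit:
  assumes "F \<noteq> bot" "(f \<longlongrightarrow> a) F" "(g \<longlongrightarrow> b) F" "\<forall>\<^sub>F i in F. f i \<preceq> g i"
  shows "a \<preceq> b"
  unfolding cone_le_def
  by (rule Lim_in_closed_set[OF closed_K _ assms(1) tendsto_diff[OF assms(3,2)]])
    (use assms(4) in \<open>simp add: cone_le_def\<close>)

text \<open>An Archimedean property, obtained by letting \<open>s\<close> decrease to 0. It turns
  Thompson estimates that hold for every positive exponent into plain inequalities.\<close>

lemma le_of_le_exp:
  assumes "\<And>s. s > 0 \<Longrightarrow> a \<preceq> exp s *\<^sub>R b"
  shows "a \<preceq> b"
proof (rule le_limit[of "at_right (0::real)" "\<lambda>_. a" a "\<lambda>s. exp s *\<^sub>R b" b])
  have "((\<lambda>s::real. exp s *\<^sub>R b) \<longlongrightarrow> exp 0 *\<^sub>R b) (at_right 0)"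
    by (intro tendsto_intros)
  then show "((\<lambda>s::real. exp s *\<^sub>R b) \<longlongrightarrow> b) (at_right 0)" by simp
  show "\<forall>\<^sub>F s in at_right (0::real). a \<preceq> exp s *\<^sub>R b"
    using assms by (auto simp: eventually_at_right_field intro: exI[of _ 1])
qed auto

lemma le_lift_Suc:
  assumes "\<And>n. x n \<preceq> x (Suc n)" "m \<le> n"
  shows "x m \<preceq> x n"
  using assms(2) by (induction rule: dec_induct) (use assms(1) le_refl le_trans in blast)+

section \<open>Order estimates from the Thompson metric\<close>

text \<open>A strict bound on the infimum yields an admissible exponent at once, without asking
  whether the infimum is attained.\<close>

lemma thompson_less_iff:
  "thompson K x y < ereal r \<longleftrightarrow>
     (\<exists>s\<ge>0. s < r \<and> exp (- s) *\<^sub>R x \<preceq> y \<and> y \<preceq> exp s *\<^sub>R x)"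
  by (auto simp: thompson_def Inf_less_iff)

lemma thompson_nonneg: "0 \<le> thompson K x y"
  by (auto simp: thompson_def intro!: Inf_greatest)

text \<open>For \<open>x\<close> in \<open>K\<close>, enlarging an admissible exponent keeps it
  admissible, so \<open>r\<close> itself serves. The third bound is the first one multiplied by
  \<open>exp r\<close>.\<close>

lemma thompson_lessD:
  assumes "x \<in> K" "y \<in> K" "thompson K x y < ereal r"
  shows "exp (- r) *\<^sub>R x \<preceq> y" "y \<preceq> exp r *\<^sub>R x" "x \<preceq> exp r *\<^sub>R y"
proof -
  obtain s where s: "s < r" "exp (- s) *\<^sub>R x \<preceq> y" "y \<preceq> exp s *\<^sub>R x"
    using assms(3) by (auto simp: thompson_less_iff)
  show 1: "exp (- r) *\<^sub>R x \<preceq> y" "y \<preceq> exp r *\<^sub>R x"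
    using le_trans[OF le_scale_left[OF assms(1), of "exp (- r)" "exp (- s)"] s(2)]
      le_trans[OF s(3) le_scale_left[OF assms(1), of "exp s" "exp r"]] s(1) by auto
  show "x \<preceq> exp r *\<^sub>R y"
    using le_scale[OF 1(1), of "exp r"] by (simp flip: exp_add)
qed

lemma thompson_lessI:
  assumes "x \<preceq> exp s *\<^sub>R y" "y \<preceq> exp s *\<^sub>R x" "0 \<le> s" "s < r"
  shows "thompson K x y < ereal r"
proof -
  have "exp (- s) *\<^sub>R x \<preceq> y"
    using le_scale[OF assms(1), of "exp (- s)"] by (simp flip: exp_add)
  then show ?thesis using assms by (auto simp: thompson_less_iff)
qed

text \<open>Only the upper side of the limit carries information, since \<open>thompson\<close> is
  nonnegative; extended real thresholds reduce to real ones by density.\<close>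

lemma thompson_tendsto_zero_iff:
  "(\<lambda>n. thompson K (x n) l) \<longlonglongrightarrow> 0 \<longleftrightarrow>
     (\<forall>e>0. \<forall>\<^sub>F n in sequentially. thompson K (x n) l < ereal e)"
proof
  assume L: "(\<lambda>n. thompson K (x n) l) \<longlonglongrightarrow> 0"
  show "\<forall>e>0. \<forall>\<^sub>F n in sequentially. thompson K (x n) l < ereal e"
    by (intro allI impI order_tendstoD(2)[OF L]) simp
next
  assume R: "\<forall>e>0. \<forall>\<^sub>F n in sequentially. thompson K (x n) l < ereal e"
  show "(\<lambda>n. thompson K (x n) l) \<longlonglongrightarrow> 0"
  proof (rule order_tendstoI)
    fix a :: ereal assume "a < 0"
    then show "\<forall>\<^sub>F n in sequentially. a < thompson K (x n) l"
      using thompson_nonneg less_le_trans by (intro always_eventually) blast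
  next
    fix a :: ereal assume "0 < a"
    then obtain e where "0 < ereal e" "ereal e < a"
      using ereal_dense2 by blast
    then show "\<forall>\<^sub>F n in sequentially. thompson K (x n) l < a"
      using R by (auto elim!: eventually_mono dest: spec[of _ e])
  qed
qed

section \<open>Completeness by components\<close>

lemma linked_trans: "(x, y) \<in> linked K \<Longrightarrow> (y, z) \<in> linked K \<Longrightarrow> (x, z) \<in> linked K"
proof -
  assume "(x, y) \<in> linked K" "(y, z) \<in> linked K"
  then obtain a b c d where *: "x \<in> K" "z \<in> K" "a > 0" "b > 0" "c > 0" "d > 0"
     "x \<preceq> a *\<^sub>R y" "y \<preceq> b *\<^sub>R x" "y \<preceq> c *\<^sub>R z" "z \<preceq> d *\<^sub>R y"
    by (auto simp: linked_def)
  have "x \<preceq> (a * c) *\<^sub>R z"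
    using le_trans[OF *(7) le_scale[OF *(9), of a]] * by simp
  moreover have "z \<preceq> (d * b) *\<^sub>R x"
    using le_trans[OF *(10) le_scale[OF *(8), of d]] * by simp
  ultimately show "(x, z) \<in> linked K"
    using * unfolding linked_def mem_Collect_eq prod.case by (metis mult_pos_pos)
qed

lemma linked_of_thompson_less:
  assumes "x \<in> K" "y \<in> K" "thompson K x y < ereal r"
  shows "(x, y) \<in> linked K"
  using thompson_lessD[OF assms] assms unfolding linked_def
  by (auto intro!: exI[of _ "exp r"])

text \<open>Points at finite Thompson distance are linked. Hence a limit stays in the component of
  its sequence, and a Cauchy sequence has a tail in a single component.\<close>

lemma complete_iff_components_complete:
  "thompson_complete K K \<longleftrightarrow> (\<forall>C\<in>components_of_cone K. thompson_complete K C)"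
proof (intro iffI ballI)
  fix C assume K: "thompson_complete K K" and "C \<in> components_of_cone K"
  then obtain a where a: "a \<in> K" "C = linked K `` {a}"
    by (auto simp: components_of_cone_def elim: quotientE)
  show "thompson_complete K C"
    unfolding thompson_complete_def
  proof (intro allI impI)
    fix x assume x: "range x \<subseteq> C \<and> thompson_Cauchy K x"
    have "C \<subseteq> K" using a by (auto simp: linked_def)
    with x K obtain l where l: "l \<in> K" "(\<lambda>n. thompson K (x n) l) \<longlonglongrightarrow> 0"
      unfolding thompson_complete_def by blast
    have "\<forall>\<^sub>F n in sequentially. thompson K (x n) l < ereal 1"
      using l(2) unfolding thompson_tendsto_zero_iff by simp
    then obtain n where "thompson K (x n) l < ereal 1"
      by (auto simp: eventually_sequentially)
    then have "(x n, l) \<in> linked K"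
      using x \<open>C \<subseteq> K\<close> l by (intro linked_of_thompson_less) auto
    moreover have "(a, x n) \<in> linked K" using x a by auto
    ultimately have "l \<in> C" using a linked_trans by blast
    with l show "\<exists>l\<in>C. (\<lambda>n. thompson K (x n) l) \<longlonglongrightarrow> 0" by blast
  qed
next
  assume C: "\<forall>C\<in>components_of_cone K. thompson_complete K C"
  show "thompson_complete K K"
    unfolding thompson_complete_def
  proof (intro allI impI)
    fix x assume x: "range x \<subseteq> K \<and> thompson_Cauchy K x"
    then obtain N where N: "\<And>m n. m \<ge> N \<Longrightarrow> n \<ge> N \<Longrightarrow> thompson K (x m) (x n) < ereal 1"
      unfolding thompson_Cauchy_def by (metis zero_less_one)
    \<comment> \<open>This component captures every term from \<open>N\<close> on; earlier terms may
      lie elsewhere, hence the shift by \<open>N\<close>.\<close>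
    define C where "C = linked K `` {x N}"
    have "range (\<lambda>n. x (n + N)) \<subseteq> C"
      using x N by (auto simp: C_def intro!: linked_of_thompson_less[of _ _ 1])
    moreover have "thompson_Cauchy K (\<lambda>n. x (n + N))"
      using x unfolding thompson_Cauchy_def by (meson trans_le_add1)
    moreover have "thompson_complete K C"
      using C x by (auto simp: components_of_cone_def C_def intro: quotientI)
    ultimately obtain l where l: "l \<in> C" "(\<lambda>n. thompson K (x (n + N)) l) \<longlonglongrightarrow> 0"
      unfolding thompson_complete_def by blast
    then have "(\<lambda>n. thompson K (x n) l) \<longlonglongrightarrow> 0"
      by (simp add: LIMSEQ_offset[of _ N])
    moreover have "l \<in> K" using l by (auto simp: C_def linked_def)
    ultimately show "\<exists>l\<in>K. (\<lambda>n. thompson K (x n) l) \<longlonglongrightarrow> 0" by blast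
  qed
qed

section \<open>From Thompson completeness to self-completeness\<close>

lemma thompson_Cauchy_of_tails:
  assumes "\<And>e. e > 0 \<Longrightarrow> \<exists>N. \<forall>m\<ge>N. \<forall>n\<ge>N. x m \<preceq> exp e *\<^sub>R x n"
  shows "thompson_Cauchy K x"
  unfolding thompson_Cauchy_def
proof (intro allI impI)
  fix e :: real assume "e > 0"
  then obtain N where "\<forall>m\<ge>N. \<forall>n\<ge>N. x m \<preceq> exp (e/2) *\<^sub>R x n"
    using assms[of "e/2"] by auto
  then show "\<exists>N. \<forall>m\<ge>N. \<forall>n\<ge>N. thompson K (x m) (x n) < ereal e"
    using \<open>e > 0\<close> by (intro exI[of _ N]) (auto intro!: thompson_lessI[of _ "e/2"])
qed

lemma thompson_limitD:
  assumes "range x \<subseteq> K" "l \<in> K" "(\<lambda>n. thompson K (x n) l) \<longlonglongrightarrow> 0" "s > 0"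
  shows "\<exists>N. \<forall>n\<ge>N. x n \<preceq> exp s *\<^sub>R l \<and> l \<preceq> exp s *\<^sub>R x n"
proof -
  obtain N where "\<forall>n\<ge>N. thompson K (x n) l < ereal s"
    using assms(3,4) unfolding thompson_tendsto_zero_iff eventually_sequentially by blast
  then show ?thesis
    using thompson_lessD[OF _ assms(2), of "x _" s] assms(1)
    by (intro exI[of _ N]) (simp add: image_subset_iff)
qed

text \<open>A monotone self-bounded sequence is Thompson Cauchy. Its limit is the supremum or
  infimum because every inequality required holds up to a factor \<open>exp s\<close> for each
  \<open>s > 0\<close>.\<close>

lemma self_complete_of_complete:
  assumes complete: "thompson_complete K K"
  shows "self_complete K K"
  unfolding self_complete_def upper_self_complete_def lower_self_complete_def
proof (intro conjI allI impI)
  fix x :: "nat \<Rightarrow> 'a"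
  assume "range x \<subseteq> K \<and> monotone (\<le>) (\<preceq>) x \<and> self_bounded K x"
  then have x: "range x \<subseteq> K" and mono: "\<And>m n. m \<le> n \<Longrightarrow> x m \<preceq> x n"
    and bdd: "upper_self_bounded K x"
    by (auto simp: monotone_def self_bounded_def)
  have "thompson_Cauchy K x"
  proof (rule thompson_Cauchy_of_tails)
    fix e :: real assume "e > 0"
    then obtain N where N: "\<forall>n\<ge>N. x n \<preceq> exp e *\<^sub>R x N"
      using bdd unfolding upper_self_bounded_def by (metis one_less_exp_iff)
    \<comment> \<open>Here \<open>x m\<close> is below \<open>exp e *\<^sub>R x N\<close>, and
      \<open>x N\<close> is below \<open>x n\<close> by monotonicity.\<close>
    then have "\<forall>m\<ge>N. \<forall>n\<ge>N. x m \<preceq> exp e *\<^sub>R x n"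
      by (meson exp_ge_zero le_scale le_trans mono)
    then show "\<exists>N. \<forall>m\<ge>N. \<forall>n\<ge>N. x m \<preceq> exp e *\<^sub>R x n" ..
  qed
  with complete x obtain l where l: "l \<in> K" "(\<lambda>n. thompson K (x n) l) \<longlonglongrightarrow> 0"
    unfolding thompson_complete_def by blast
  have "is_cone_sup K (range x) l"
    unfolding is_cone_sup_def
  proof (intro conjI ballI allI impI)
    fix a assume "a \<in> range x"
    then obtain m where m: "a = x m" by blast
    show "a \<preceq> l"
    proof (rule le_of_le_exp)
      fix s :: real assume "s > 0"
      then obtain N where "\<forall>n\<ge>N. x n \<preceq> exp s *\<^sub>R l"
        using thompson_limitD[OF x l] by blast
      then have "x (max m N) \<preceq> exp s *\<^sub>R l" by simp
      then show "a \<preceq> exp s *\<^sub>R l"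
        using mono[of m "max m N"] m by (auto intro: le_trans)
    qed
  next
    fix u assume u: "\<forall>a\<in>range x. a \<preceq> u"
    show "l \<preceq> u"
    proof (rule le_of_le_exp)
      fix s :: real assume "s > 0"
      then obtain N where "l \<preceq> exp s *\<^sub>R x N"
        using thompson_limitD[OF x l] by blast
      then show "l \<preceq> exp s *\<^sub>R u"
        using u le_scale[of "x N" u "exp s"] by (auto intro: le_trans)
    qed
  qed
  with l show "\<exists>s\<in>K. is_cone_sup K (range x) s" by blast
next
  fix x :: "nat \<Rightarrow> 'a"
  assume "range x \<subseteq> K \<and> monotone (\<le>) (\<lambda>a b. b \<preceq> a) x \<and> self_bounded K x"
  then have x: "range x \<subseteq> K" and mono: "\<And>m n. m \<le> n \<Longrightarrow> x n \<preceq> x m"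
    and bdd: "lower_self_bounded K x"
    by (auto simp: monotone_def self_bounded_def)
  have "thompson_Cauchy K x"
  proof (rule thompson_Cauchy_of_tails)
    fix e :: real assume "e > 0"
    then have "0 < exp (- e)" "exp (- e) < 1" by auto
    then obtain N where N: "\<forall>n\<ge>N. exp (- e) *\<^sub>R x N \<preceq> x n"
      using bdd unfolding lower_self_bounded_def by blast
    have "x m \<preceq> exp e *\<^sub>R x n" if "m \<ge> N" "n \<ge> N" for m n
    proof -
      have "x N \<preceq> exp e *\<^sub>R x n"
        using le_scale[of "exp (- e) *\<^sub>R x N" "x n" "exp e"] N that by (simp flip: exp_add)
      then show ?thesis using mono[OF that(1)] le_trans by blast
    qed
    then show "\<exists>N. \<forall>m\<ge>N. \<forall>n\<ge>N. x m \<preceq> exp e *\<^sub>R x n" by blast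
  qed
  with complete x obtain l where l: "l \<in> K" "(\<lambda>n. thompson K (x n) l) \<longlonglongrightarrow> 0"
    unfolding thompson_complete_def by blast
  have "is_cone_inf K (range x) l"
    unfolding is_cone_inf_def
  proof (intro conjI ballI allI impI)
    fix a assume "a \<in> range x"
    then obtain m where m: "a = x m" by blast
    show "l \<preceq> a"
    proof (rule le_of_le_exp)
      fix s :: real assume "s > 0"
      then obtain N where "\<forall>n\<ge>N. l \<preceq> exp s *\<^sub>R x n"
        using thompson_limitD[OF x l] by blast
      then have "l \<preceq> exp s *\<^sub>R x (max m N)" by simp
      then show "l \<preceq> exp s *\<^sub>R a"
        using le_scale[OF mono[of m "max m N"], of "exp s"] m by (auto intro: le_trans)
    qed
  next
    fix u assume u: "\<forall>a\<in>range x. u \<preceq> a"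
    show "u \<preceq> l"
    proof (rule le_of_le_exp)
      fix s :: real assume "s > 0"
      then obtain N where "x N \<preceq> exp s *\<^sub>R l"
        using thompson_limitD[OF x l] by blast
      then show "u \<preceq> exp s *\<^sub>R l"
        using u by (auto intro: le_trans)
    qed
  qed
  with l show "\<exists>s\<in>K. is_cone_inf K (range x) s" by blast
qed (use zero_mem in auto)

section \<open>Criteria for normality\<close>

text \<open>Scaling spreads a single order-convex neighborhood inside the unit ball to all pairs
  \<open>x\<close>, \<open>y\<close>. Conversely, the order-convex hulls of balls form the required
  basis.\<close>

lemma normal_iff_monotone_norm:
  "normal_cone K \<longleftrightarrow> (\<exists>c\<ge>0. \<forall>x y. 0 \<preceq> x \<and> x \<preceq> y \<longrightarrow> norm x \<le> c * norm y)"
proof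
  assume "normal_cone K"
  then obtain N where N: "0 \<in> interior N" "order_convex K N" "N \<subseteq> ball 0 1"
    unfolding normal_cone_def by (metis centre_in_ball interior_open open_ball zero_less_one)
  then obtain \<delta> where d: "\<delta> > 0" "cball 0 \<delta> \<subseteq> N"
    by (meson mem_interior_cball)
  have "norm x \<le> (1 / \<delta>) * norm y" if xy: "0 \<preceq> x" "x \<preceq> y" for x y
  proof (cases "y = 0")
    case True
    then show ?thesis using xy le_antisym by fastforce
  next
    case False
    \<comment> \<open>Scales \<open>y\<close> to norm \<open>\<delta>\<close>, so that it falls into
      \<open>cball 0 \<delta>\<close>.\<close>
    let ?a = "\<delta> / norm y"
    have "?a *\<^sub>R y \<in> N" "0 \<in> N"
      using d False by (auto intro!: subsetD[OF d(2)])
    moreover have "0 \<preceq> ?a *\<^sub>R x" "?a *\<^sub>R x \<preceq> ?a *\<^sub>R y"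
      using le_scale[OF xy(1), of ?a] le_scale[OF xy(2), of ?a] d by auto
    ultimately have "?a *\<^sub>R x \<in> N"
      using N(2) unfolding order_convex_def by blast
    then have "norm (?a *\<^sub>R x) < 1" using N(3) by auto
    then have "\<delta> * norm x < norm y"
      using d False by (simp add: field_simps)
    then show ?thesis using d by (simp add: field_simps)
  qed
  then show "\<exists>c\<ge>0. \<forall>x y. 0 \<preceq> x \<and> x \<preceq> y \<longrightarrow> norm x \<le> c * norm y"
    using d by (intro exI[of _ "1 / \<delta>"]) auto
next
  assume "\<exists>c\<ge>0. \<forall>x y. 0 \<preceq> x \<and> x \<preceq> y \<longrightarrow> norm x \<le> c * norm y"
  then obtain c where c: "c \<ge> 0" "\<And>x y. 0 \<preceq> x \<Longrightarrow> x \<preceq> y \<Longrightarrow> norm x \<le> c * norm y"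
    by blast
  \<comment> \<open>The order-convex hull of \<open>ball 0 r\<close>; the next bound shows that
    these hulls still shrink to 0.\<close>
  define sandwich where "sandwich r = {z. \<exists>a\<in>ball 0 r. \<exists>b\<in>ball 0 r. a \<preceq> z \<and> z \<preceq> b}" for r
  have bound: "norm z \<le> (1 + 2 * c) * r" if z: "z \<in> sandwich r" for z r
  proof -
    obtain a b where ab: "norm a < r" "norm b < r" "a \<preceq> z" "z \<preceq> b"
      using z by (auto simp: sandwich_def)
    have "norm (z - a) \<le> c * norm (b - a)"
      using ab by (intro c) (auto simp: cone_le_def)
    also have "\<dots> \<le> c * (2 * r)"
      using ab c norm_triangle_ineq4[of b a] by (intro mult_left_mono) auto
    finally show ?thesis
      using ab norm_triangle_ineq[of "z - a" a] by (simp add: algebra_simps)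
  qed
  show "normal_cone K"
    unfolding normal_cone_def
  proof (intro exI[of _ "sandwich ` {0<..}"] conjI ballI allI impI)
    fix N assume "N \<in> sandwich ` {0<..}"
    then obtain r where r: "r > 0" "N = sandwich r" by auto
    have "ball 0 r \<subseteq> N"
      using r le_refl by (auto simp: sandwich_def)
    then show "0 \<in> interior N"
      using r by (auto simp: mem_interior)
    show "order_convex K N"
      unfolding order_convex_def r sandwich_def by (blast intro: le_trans)
  next
    fix V :: "'a set" assume "0 \<in> interior V"
    then obtain e where e: "e > 0" "cball 0 e \<subseteq> V"
      by (meson mem_interior_cball)
    define r where "r = e / (1 + 2 * c)"
    have "(1 + 2 * c) * r = e" "r > 0" using c e by (auto simp: r_def)
    then have "sandwich r \<subseteq> V"
      using bound[of _ r] e by auto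
    then show "\<exists>N\<in>sandwich ` {0<..}. N \<subseteq> V" using \<open>r > 0\<close> by blast
  qed
qed

lemma normal_of_bounded_intervals:
  assumes bounded: "\<And>u. u \<in> K \<Longrightarrow> \<exists>B. \<forall>y. 0 \<preceq> y \<and> y \<preceq> u \<longrightarrow> norm y \<le> B"
  shows "normal_cone K"
proof (rule ccontr)
  assume "\<not> normal_cone K"
  \<comment> \<open>Of the factor \<open>4 ^ n\<close>, one \<open>2 ^ n\<close> pays for
    summability of the rescaled upper elements, and the other keeps the rescaled lower elements
    unbounded.\<close>
  then have "\<exists>x y. 0 \<preceq> y \<and> y \<preceq> x \<and> norm y > 4 ^ n * norm x" for n :: nat
    unfolding normal_iff_monotone_norm not_le[symmetric]
    by (metis zero_le_numeral zero_le_power)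
  then obtain X Y where XY: "\<And>n. 0 \<preceq> Y n" "\<And>n. Y n \<preceq> X n"
      "\<And>n::nat. norm (Y n) > 4 ^ n * norm (X n)"
    by metis
  \<comment> \<open>If \<open>X n\<close> were 0, then \<open>Y n\<close> would be 0 by
    antisymmetry, against the strict inequality.\<close>
  have X0: "norm (X n) > 0" for n
    using XY(1)[of n] XY(2)[of n] XY(3)[of n] le_antisym by fastforce
  define a where "a n = 1 / (2 ^ n * norm (X n))" for n
  have a: "a n > 0" for n using X0[of n] by (simp add: a_def)
  define x where "x n = a n *\<^sub>R X n" for n
  have norm_x: "norm (x n) = (1/2) ^ n" for n
    using X0[of n] by (simp add: x_def a_def power_one_over)
  have x_mem: "x n \<in> K" for n
    using XY[of n] le_trans[of 0] a[of n] by (auto simp: x_def le_zero_iff intro: scale_mem)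
  have summable: "summable x"
    by (rule summable_norm_cancel) (simp add: norm_x)
  have sum_mem: "(\<Sum>i\<in>A. x i) \<in> K" for A
    by (induction A rule: infinite_finite_induct) (auto intro: zero_mem add_mem x_mem)
  have le_u: "x n \<preceq> suminf x" for n
  proof (rule le_limit[OF _ tendsto_const summable_LIMSEQ[OF summable]])
    have "x n \<preceq> (\<Sum>i<m. x i)" if "m > n" for m
    proof -
      have "(\<Sum>i<m. x i) - x n = (\<Sum>i\<in>{..<m} - {n}. x i)"
        using that by (simp add: sum_diff1)
      then show ?thesis using sum_mem by (simp add: cone_le_def)
    qed
    then show "\<forall>\<^sub>F m in sequentially. x n \<preceq> (\<Sum>i<m. x i)"
      by (rule eventually_mono[OF eventually_gt_at_top])
  qed simp
  have "suminf x \<in> K"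
    using le_trans[OF _ le_u[of 0], of 0] x_mem by (simp add: le_zero_iff)
  then obtain B where B: "\<And>y. 0 \<preceq> y \<Longrightarrow> y \<preceq> suminf x \<Longrightarrow> norm y \<le> B"
    using bounded by meson
  have "2 ^ n \<le> B" for n :: nat
  proof -
    have "a n *\<^sub>R Y n \<preceq> suminf x"
      using le_scale[OF XY(2)[of n], of "a n"] a[of n] le_u[of n] le_trans by (auto simp: x_def)
    moreover have "0 \<preceq> a n *\<^sub>R Y n"
      using XY(1)[of n] a[of n] by (auto simp: le_zero_iff intro: scale_mem)
    ultimately have "norm (a n *\<^sub>R Y n) \<le> B" using B by blast
    moreover have "norm (a n *\<^sub>R Y n) \<ge> 2 ^ n"
    proof -
      have "2 ^ n * (2 ^ n * norm (X n)) \<le> norm (Y n)"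
        using XY(3)[of n] by (simp add: mult.assoc[symmetric] flip: power_mult_distrib)
      then show ?thesis using X0[of n] by (simp add: a_def field_simps)
    qed
    ultimately show ?thesis by linarith
  qed
  then show False
    using real_arch_pow[of 2 B] by (auto simp: not_less[symmetric])
qed

section \<open>Consequences of normality: completeness and comparison of topologies\<close>

text \<open>Write \<open>y - x\<close> as \<open>y - exp (- s) *\<^sub>R x\<close> minus
  \<open>(1 - exp (- s)) *\<^sub>R x\<close>. The first part lies between 0 and
  \<open>(exp s - exp (- s)) *\<^sub>R x\<close>, so \<open>c\<close> controls its norm.\<close>

lemma norm_diff_le_of_linked:
  assumes c: "\<And>x y. 0 \<preceq> x \<Longrightarrow> x \<preceq> y \<Longrightarrow> norm x \<le> c * norm y"
    and "0 \<le> s" "exp (- s) *\<^sub>R x \<preceq> y" "y \<preceq> exp s *\<^sub>R x"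
  shows "norm (y - x) \<le> ((1 - exp (- s)) + c * (exp s - exp (- s))) * norm x"
proof -
  have eq: "norm ((exp s - exp (- s)) *\<^sub>R x) = (exp s - exp (- s)) * norm x"
    "norm ((1 - exp (- s)) *\<^sub>R x) = (1 - exp (- s)) * norm x"
    using \<open>0 \<le> s\<close> by simp_all
  have 1: "norm (y - exp (- s) *\<^sub>R x) \<le> c * norm ((exp s - exp (- s)) *\<^sub>R x)"
    using assms by (intro c) (simp_all add: cone_le_def algebra_simps)
  have 2: "norm (y - x) \<le> norm (y - exp (- s) *\<^sub>R x) + norm ((1 - exp (- s)) *\<^sub>R x)"
    using norm_triangle_ineq4[of "y - exp (- s) *\<^sub>R x" "(1 - exp (- s)) *\<^sub>R x"]
    by (simp add: algebra_simps)
  show ?thesis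
    using 1[unfolded eq] 2[unfolded eq] by (simp add: distrib_right mult.assoc)
qed

text \<open>The factor in the preceding estimate is continuous in \<open>s\<close> and vanishes at
  0.\<close>

lemma deviation_bound_small:
  assumes "e > 0"
  shows "\<exists>r>0. \<forall>s. 0 \<le> s \<and> s < r \<longrightarrow> ((1 - exp (- s)) + c * (exp s - exp (- s))) * M < (e::real)"
proof -
  define h where "h s = ((1 - exp (- s)) + c * (exp s - exp (- s))) * M" for s :: real
  have "isCont h 0" unfolding h_def by (intro continuous_intros)
  moreover have "h 0 = 0" by (simp add: h_def)
  ultimately obtain r where "r > 0" "\<And>s. \<bar>s\<bar> < r \<Longrightarrow> \<bar>h s\<bar> < e"
    using assms unfolding continuous_at_eps_delta dist_real_def by (metis diff_zero)
  then have "h s < e" if "0 \<le> s" "s < r" for s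
    using that by (metis abs_less_iff abs_of_nonneg)
  with \<open>r > 0\<close> show ?thesis unfolding h_def by blast
qed

lemma complete_of_normal:
  assumes "normal_cone K"
  shows "thompson_complete K K"
  unfolding thompson_complete_def
proof (intro allI impI)
  fix x assume "range x \<subseteq> K \<and> thompson_Cauchy K x"
  then have x: "x n \<in> K" and Cauchy: "thompson_Cauchy K x" for n by auto
  obtain c where c: "c \<ge> 0" "\<And>x y. 0 \<preceq> x \<Longrightarrow> x \<preceq> y \<Longrightarrow> norm x \<le> c * norm y"
    using assms normal_iff_monotone_norm by blast
  obtain N where N: "\<And>n. n \<ge> N \<Longrightarrow> thompson K (x N) (x n) < ereal 1"
    using Cauchy unfolding thompson_Cauchy_def by (metis order_refl zero_less_one)
  \<comment> \<open>One norm bound for the whole tail, so that a single \<open>r\<close> serves all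
    pairs of terms.\<close>
  define M where "M = c * norm (exp 1 *\<^sub>R x N)"
  have M: "norm (x n) \<le> M" if "n \<ge> N" for n
    unfolding M_def using x thompson_lessD(2)[OF _ _ N[OF that]]
    by (intro c) (auto simp: le_zero_iff)
  have "Cauchy x"
  proof (rule metric_CauchyI)
    fix e :: real assume "e > 0"
    then obtain r where r: "r > 0"
      "\<And>s. 0 \<le> s \<Longrightarrow> s < r \<Longrightarrow> ((1 - exp (- s)) + c * (exp s - exp (- s))) * M < e"
      using deviation_bound_small[of e c M] by blast
    obtain N' where N': "\<And>m n. m \<ge> N' \<Longrightarrow> n \<ge> N' \<Longrightarrow> thompson K (x m) (x n) < ereal r"
      using Cauchy r(1) unfolding thompson_Cauchy_def by blast
    have "dist (x m) (x n) < e" if mn: "m \<ge> max N N'" "n \<ge> max N N'" for m n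
    proof -
      obtain s where s: "0 \<le> s" "s < r" "exp (- s) *\<^sub>R x m \<preceq> x n" "x n \<preceq> exp s *\<^sub>R x m"
        using N'[of m n] mn by (auto simp: thompson_less_iff)
      have "norm (x n - x m) \<le> ((1 - exp (- s)) + c * (exp s - exp (- s))) * norm (x m)"
        by (rule norm_diff_le_of_linked[OF c(2) s(1,3,4)])
      also have "\<dots> \<le> ((1 - exp (- s)) + c * (exp s - exp (- s))) * M"
        using c(1) s(1) mn M[of m] by (intro mult_left_mono) auto
      also have "\<dots> < e" using r s by blast
      finally show ?thesis by (simp add: dist_norm norm_minus_commute)
    qed
    then show "\<exists>N. \<forall>m\<ge>N. \<forall>n\<ge>N. dist (x m) (x n) < e" by blast
  qed
  then obtain l where l: "x \<longlonglongrightarrow> l"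
    using Cauchy_convergent_iff convergent_def by blast
  have "l \<in> K" by (rule closed_sequentially[OF closed_K x l])
  moreover have "(\<lambda>n. thompson K (x n) l) \<longlonglongrightarrow> 0"
    unfolding thompson_tendsto_zero_iff eventually_sequentially
  proof (intro allI impI)
    fix e :: real assume "e > 0"
    \<comment> \<open>Letting \<open>m\<close> grow preserves the non-strict bounds with exponent
      \<open>e/2\<close>, which leaves room for the strict bound \<open>e\<close>.\<close>
    then obtain N where N: "\<And>m n. m \<ge> N \<Longrightarrow> n \<ge> N \<Longrightarrow> thompson K (x m) (x n) < ereal (e/2)"
      using Cauchy unfolding thompson_Cauchy_def by (meson half_gt_zero)
    have "thompson K (x n) l < ereal e" if n: "n \<ge> N" for n
    proof (rule thompson_lessI[of _ "e/2"])
      have *: "x n \<preceq> exp (e/2) *\<^sub>R x m" "x m \<preceq> exp (e/2) *\<^sub>R x n" if "m \<ge> N" for m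
        using thompson_lessD[OF x x N[OF n that]] by auto
      have ev: "\<forall>\<^sub>F m in sequentially. x n \<preceq> exp (e/2) *\<^sub>R x m"
        "\<forall>\<^sub>F m in sequentially. x m \<preceq> exp (e/2) *\<^sub>R x n"
        using * by (auto simp: eventually_sequentially)
      have lim: "(\<lambda>m. exp (e/2) *\<^sub>R x m) \<longlonglongrightarrow> exp (e/2) *\<^sub>R l"
        by (intro tendsto_intros l)
      show "x n \<preceq> exp (e/2) *\<^sub>R l"
        by (rule le_limit[OF _ tendsto_const lim ev(1)]) simp
      show "l \<preceq> exp (e/2) *\<^sub>R x n"
        by (rule le_limit[OF _ l tendsto_const ev(2)]) simp
    qed (use \<open>e > 0\<close> in auto)
    then show "\<exists>N. \<forall>n\<ge>N. thompson K (x n) l < ereal e" by blast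
  qed
  ultimately show "\<exists>l\<in>K. (\<lambda>n. thompson K (x n) l) \<longlonglongrightarrow> 0" by blast
qed

lemma thompson_topology_finer_of_normal:
  assumes "normal_cone K" "openin (top_of_set K) U"
  shows "openin (thompson_topology K) U"
  unfolding openin_thompson_topology
proof (intro conjI ballI)
  show "U \<subseteq> K" by (rule openin_imp_subset[OF assms(2)])
  obtain c where c: "c \<ge> 0" "\<And>x y. 0 \<preceq> x \<Longrightarrow> x \<preceq> y \<Longrightarrow> norm x \<le> c * norm y"
    using assms(1) normal_iff_monotone_norm by blast
  fix x assume "x \<in> U"
  then obtain e where e: "e > 0" "ball x e \<inter> K \<subseteq> U"
    using assms(2) unfolding openin_contains_ball by blast
  then obtain r where r: "r > 0"
      "\<And>s. 0 \<le> s \<Longrightarrow> s < r \<Longrightarrow> ((1 - exp (- s)) + c * (exp s - exp (- s))) * norm x < e"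
    using deviation_bound_small[of e c "norm x"] by blast
  have "y \<in> U" if y: "y \<in> thompson_ball K x r" for y
  proof -
    obtain s where s: "0 \<le> s" "s < r" "exp (- s) *\<^sub>R x \<preceq> y" "y \<preceq> exp s *\<^sub>R x" "y \<in> K"
      using y by (auto simp: thompson_ball_def thompson_less_iff)
    have "norm (y - x) < e"
      using norm_diff_le_of_linked[OF c(2) s(1,3,4)] r(2)[OF s(1,2)] by linarith
    then have "y \<in> ball x e \<inter> K"
      using s(5) by (simp add: dist_norm norm_minus_commute)
    then show ?thesis using e(2) by blast
  qed
  with r(1) show "\<exists>r>0. thompson_ball K x r \<subseteq> U" by blast
qed

section \<open>Normality from the comparison of topologies\<close>

lemma normal_of_thompson_topology_finer:
  assumes finer: "\<And>U. openin (top_of_set K) U \<Longrightarrow> openin (thompson_topology K) U"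
  shows "normal_cone K"
proof (rule normal_of_bounded_intervals)
  fix u assume u: "u \<in> K"
  have "openin (thompson_topology K) (K \<inter> ball u 1)"
    by (intro finer openin_open_Int open_ball)
  then obtain r where r: "r > 0" "thompson_ball K u r \<subseteq> K \<inter> ball u 1"
    using u unfolding openin_thompson_topology by (meson IntI centre_in_ball zero_less_one)
  \<comment> \<open>Chosen so that \<open>1 + t = exp (r/2)\<close>: then
    \<open>u + t *\<^sub>R y\<close> is at most \<open>exp (r/2) *\<^sub>R u\<close>.\<close>
  define t where "t = exp (r/2) - 1"
  have t: "t > 0" using r by (simp add: t_def)
  have "norm y \<le> 1 / t" if y: "0 \<preceq> y" "y \<preceq> u" for y
  proof -
    have ty: "0 \<preceq> t *\<^sub>R y" "t *\<^sub>R y \<preceq> t *\<^sub>R u"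
      using le_scale[OF y(1), of t] le_scale[OF y(2), of t] t by auto
    have "thompson K u (u + t *\<^sub>R y) < ereal r"
    proof (rule thompson_lessI[of _ "r/2"])
      have "u \<preceq> u + t *\<^sub>R y" using le_add[OF le_refl[of u] ty(1)] by simp
      also have "\<dots> \<preceq> exp (r/2) *\<^sub>R (u + t *\<^sub>R y)"
        using le_scale_left[of "u + t *\<^sub>R y" 1 "exp (r/2)"] add_mem[OF u, of "t *\<^sub>R y"] ty(1) r
        by (simp add: le_zero_iff)
      finally show "u \<preceq> exp (r/2) *\<^sub>R (u + t *\<^sub>R y)" .
      show "u + t *\<^sub>R y \<preceq> exp (r/2) *\<^sub>R u"
        using le_add[OF le_refl[of u] ty(2)] by (simp add: t_def algebra_simps)
    qed (use r in auto)
    then have "u + t *\<^sub>R y \<in> thompson_ball K u r"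
      using add_mem[OF u, of "t *\<^sub>R y"] ty(1) by (simp add: thompson_ball_def le_zero_iff)
    then have "u + t *\<^sub>R y \<in> ball u 1" using r(2) by blast
    then have "t * norm y < 1" using t by (simp add: dist_norm)
    then show ?thesis using t by (simp add: field_simps)
  qed
  then show "\<exists>B. \<forall>y. 0 \<preceq> y \<and> y \<preceq> u \<longrightarrow> norm y \<le> B" by blast
qed

section \<open>Order balls and convergence of rapidly Cauchy sequences\<close>

text \<open>The order interval from \<open>- t *\<^sub>R u\<close> to \<open>t *\<^sub>R u\<close>,
  which serves as the closed ball of radius \<open>t\<close> for the order-unit norm of
  \<open>u\<close>.\<close>

definition order_ball :: "'a \<Rightarrow> real \<Rightarrow> 'a set" where
  "order_ball u t = {v. v \<preceq> t *\<^sub>R u \<and> - v \<preceq> t *\<^sub>R u}"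

lemma order_ball_mono: "u \<in> K \<Longrightarrow> s \<le> t \<Longrightarrow> order_ball u s \<subseteq> order_ball u t"
  using le_trans[OF _ le_scale_left[of u s t]] by (auto simp: order_ball_def)

lemma order_ball_add:
  "v \<in> order_ball u s \<Longrightarrow> w \<in> order_ball u t \<Longrightarrow> v + w \<in> order_ball u (s + t)"
  using le_add[of v "s *\<^sub>R u" w "t *\<^sub>R u"] le_add[of "- v" "s *\<^sub>R u" "- w" "t *\<^sub>R u"]
  by (simp add: order_ball_def algebra_simps)

lemma order_ball_uminus_iff: "- v \<in> order_ball u t \<longleftrightarrow> v \<in> order_ball u t"
  by (auto simp: order_ball_def)

lemma order_ball_diff:
  "v \<in> order_ball u s \<Longrightarrow> w \<in> order_ball u t \<Longrightarrow> v - w \<in> order_ball u (s + t)"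
  using order_ball_add[of v u s "- w" t] by (simp add: order_ball_uminus_iff)

lemma order_ball_scale: "0 \<le> a \<Longrightarrow> v \<in> order_ball u t \<Longrightarrow> a *\<^sub>R v \<in> order_ball u (a * t)"
  using le_scale[of v "t *\<^sub>R u" a] le_scale[of "- v" "t *\<^sub>R u" a] by (simp add: order_ball_def)

text \<open>Pointedness of the cone; this makes the order-unit norm definite.\<close>

lemma order_ball_zero: "v \<in> order_ball u 0 \<longleftrightarrow> v = 0"
  using mem_antisym[of v] zero_mem by (auto simp: order_ball_def cone_le_def)

text \<open>The radius may vary along the sequence. This serves both to attain the infimum defining
  the gauge, with \<open>v\<close> constant, and to identify norm limits when the radii tend to
  0.\<close>

lemma order_ball_limit:
  assumes "v \<longlonglongrightarrow> w" "t \<longlonglongrightarrow> t'" "\<And>n. v n \<in> order_ball u (t n)"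
  shows "w \<in> order_ball u t'"
proof -
  have tu: "(\<lambda>n. t n *\<^sub>R u) \<longlonglongrightarrow> t' *\<^sub>R u" by (intro tendsto_intros assms)
  show ?thesis
    unfolding order_ball_def using assms(3)
    by (auto simp: order_ball_def intro!: le_limit[OF _ assms(1) tu] le_limit[OF _ tendsto_minus[OF assms(1)] tu])
qed

text \<open>The order intervals from \<open>lo n\<close> to \<open>hi n\<close> are nested with gap
  \<open>(4 / 2 ^ n) *\<^sub>R u\<close>. As \<open>u\<close> is below \<open>lo n\<close>, this
  additive gap is a small multiple of \<open>lo n\<close>, which gives upper self-boundedness. The
  supremum of \<open>lo\<close> lies in all these intervals; removing the shift
  \<open>(t + 3) *\<^sub>R u\<close> yields \<open>l\<close>.\<close>

lemma order_ball_Cauchy_limit: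
  assumes complete: "upper_self_complete K K" and u: "u \<in> K"
    and v0: "v 0 \<in> order_ball u t"
    and step: "\<And>n::nat. v (Suc n) - v n \<in> order_ball u (1 / 2 ^ n)"
  shows "\<exists>l. \<forall>n. l - v n \<in> order_ball u (2 / 2 ^ n)"
proof -
  \<comment> \<open>The shift makes \<open>lo\<close> increasing and \<open>hi\<close> decreasing, with \<open>u \<preceq> lo 0\<close>.\<close>
  define lo where "lo n = v n + (t + 3 - 2 / 2 ^ n) *\<^sub>R u" for n :: nat
  define hi where "hi n = v n + (t + 3 + 2 / 2 ^ n) *\<^sub>R u" for n :: nat
  have hi_eq: "hi n = lo n + (4 / 2 ^ n) *\<^sub>R u" for n
    by (simp add: hi_def lo_def algebra_simps flip: scaleR_add_left)
  have lo_Suc: "lo n \<preceq> lo (Suc n)" for n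
  proof -
    \<comment> \<open>The shift grows by \<open>2 / 2 ^ n - 2 / 2 ^ Suc n = 1 / 2 ^ n\<close>,
      exactly what absorbs the increment of \<open>v\<close>.\<close>
    have "lo (Suc n) - lo n = (1 / 2 ^ n) *\<^sub>R u + (v (Suc n) - v n)"
      by (simp add: lo_def algebra_simps flip: scaleR_add_left)
    then show ?thesis using step[of n] by (simp add: order_ball_def cone_le_def)
  qed
  have hi_Suc: "hi (Suc n) \<preceq> hi n" for n
  proof -
    have "hi n - hi (Suc n) = (1 / 2 ^ n) *\<^sub>R u - (v (Suc n) - v n)"
      by (simp add: hi_def algebra_simps flip: scaleR_add_left)
    then show ?thesis using step[of n] by (simp add: order_ball_def cone_le_def)
  qed
  have lo_mono: "lo m \<preceq> lo n" if "m \<le> n" for m n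
    using le_lift_Suc[of lo] lo_Suc that by blast
  have hi_mono: "hi n \<preceq> hi m" if "m \<le> n" for m n
    using that by (induction rule: dec_induct) (use hi_Suc le_refl le_trans in blast)+
  have lo_hi: "lo m \<preceq> hi n" for m n
  proof -
    have "lo m \<preceq> lo (max m n)" by (simp add: lo_mono)
    also have "\<dots> \<preceq> hi (max m n)"
      using scale_mem[OF u, of "4 / 2 ^ max m n"] by (simp add: hi_eq cone_le_def)
    also have "hi (max m n) \<preceq> hi n" by (simp add: hi_mono)
    finally show ?thesis .
  qed
  have u_le: "u \<preceq> lo n" for n
  proof -
    have "lo 0 - u = t *\<^sub>R u - - v 0" by (simp add: lo_def algebra_simps)
    then have "u \<preceq> lo 0" using v0 by (simp add: order_ball_def cone_le_def)
    then show ?thesis using lo_mono[of 0 n] le_trans by blast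
  qed
  then have lo_mem: "lo n \<in> K" for n using u le_trans[of 0 u] by (simp add: le_zero_iff)
  have "upper_self_bounded K lo"
    unfolding upper_self_bounded_def
  proof (intro allI impI)
    fix c :: real assume "c > 1"
    then obtain k where "(1/2) ^ k < (c - 1) / 4"
      using real_arch_pow_inv[of "(c - 1) / 4" "1/2"] by auto
    then have k: "4 / 2 ^ k \<le> c - 1" by (simp add: power_one_over field_simps)
    have "lo n \<preceq> c *\<^sub>R lo k" for n
    proof -
      have "(4 / 2 ^ k) *\<^sub>R u \<preceq> (4 / 2 ^ k) *\<^sub>R lo k" by (simp add: le_scale u_le)
      also have "\<dots> \<preceq> (c - 1) *\<^sub>R lo k" using k lo_mem le_scale_left by blast
      finally have "hi k \<preceq> lo k + (c - 1) *\<^sub>R lo k"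
        unfolding hi_eq by (intro le_add le_refl)
      then show ?thesis using lo_hi[of n k] le_trans by (auto simp: algebra_simps)
    qed
    then show "\<exists>k. \<forall>n\<ge>k. lo n \<preceq> c *\<^sub>R lo k" by blast
  qed
  moreover have "lower_self_bounded K lo"
    unfolding lower_self_bounded_def
  proof (intro allI impI)
    fix c :: real assume "0 < c \<and> c < 1"
    \<comment> \<open>Since \<open>lo\<close> increases, the index 0 works for every
      \<open>c\<close>.\<close>
    then have "c *\<^sub>R lo 0 \<preceq> lo 0" using le_scale_left[of "lo 0" c 1] lo_mem by simp
    then show "\<exists>k. \<forall>n\<ge>k. c *\<^sub>R lo k \<preceq> lo n"
      using lo_mono[of 0] le_trans by blast
  qed
  moreover have "monotone (\<le>) (\<preceq>) lo" using lo_mono by (simp add: monotone_def)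
  ultimately obtain s where s: "is_cone_sup K (range lo) s"
    using complete lo_mem unfolding upper_self_complete_def self_bounded_def by blast
  have "s - (t + 3) *\<^sub>R u - v n \<in> order_ball u (2 / 2 ^ n)" for n
  proof -
    have "lo n \<preceq> s" "s \<preceq> hi n"
      using s lo_hi unfolding is_cone_sup_def by blast+
    then show ?thesis
      by (simp add: order_ball_def lo_def hi_def cone_le_def algebra_simps)
  qed
  then show ?thesis by blast
qed

section \<open>The order-unit norm and its completeness\<close>

text \<open>\<open>order_ideal u\<close> is the span of \<open>[-u, u]\<close>, and \<open>gauge u\<close> its order-unit norm.\<close>

definition order_ideal :: "'a \<Rightarrow> 'a set" where
  "order_ideal u = (\<Union>t\<in>{0..}. order_ball u t)"

definition gauge :: "'a \<Rightarrow> 'a \<Rightarrow> real" where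
  "gauge u v = (if v \<in> order_ideal u then Inf {t. 0 \<le> t \<and> v \<in> order_ball u t} else 0)"

lemma order_ball_subset_ideal: "0 \<le> t \<Longrightarrow> order_ball u t \<subseteq> order_ideal u"
  by (auto simp: order_ideal_def)

lemma order_ideal_add: "v \<in> order_ideal u \<Longrightarrow> w \<in> order_ideal u \<Longrightarrow> v + w \<in> order_ideal u"
  unfolding order_ideal_def using order_ball_add by (fastforce intro: add_nonneg_nonneg)

lemma order_ideal_diff: "v \<in> order_ideal u \<Longrightarrow> w \<in> order_ideal u \<Longrightarrow> v - w \<in> order_ideal u"
  unfolding order_ideal_def using order_ball_diff by (fastforce intro: add_nonneg_nonneg)

lemma gauge_uminus: "gauge u (- v) = gauge u v"
  by (simp add: gauge_def order_ideal_def order_ball_uminus_iff)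

lemma gauge_nonneg: "0 \<le> gauge u v"
proof (cases "v \<in> order_ideal u")
  case True
  then have "{t. 0 \<le> t \<and> v \<in> order_ball u t} \<noteq> {}" by (auto simp: order_ideal_def)
  then have "0 \<le> Inf {t. 0 \<le> t \<and> v \<in> order_ball u t}" by (rule cInf_greatest) auto
  with True show ?thesis by (simp add: gauge_def)
qed (simp add: gauge_def)

lemma gauge_le: "0 \<le> t \<Longrightarrow> v \<in> order_ball u t \<Longrightarrow> gauge u v \<le> t"
  using order_ball_subset_ideal[of t u] unfolding gauge_def
  by (auto intro!: cInf_lower bdd_belowI[of _ 0])

text \<open>The infimum is attained: admissible radii converge to it, and the two inequalities
  defining an order ball survive the limit.\<close>

lemma mem_order_ball_gauge:
  assumes "v \<in> order_ideal u"
  shows "v \<in> order_ball u (gauge u v)"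
proof -
  let ?S = "{t. 0 \<le> t \<and> v \<in> order_ball u t}"
  have "?S \<noteq> {}" "bdd_below ?S" using assms by (auto simp: order_ideal_def)
  then have "Inf ?S \<in> closure ?S" by (rule closure_contains_Inf)
  then obtain f where f: "\<And>n. f n \<in> ?S" "f \<longlonglongrightarrow> Inf ?S"
    unfolding closure_sequential by blast
  have "v \<in> order_ball u (Inf ?S)"
    using order_ball_limit[OF tendsto_const f(2)] f(1) by blast
  with assms show ?thesis by (simp add: gauge_def)
qed

lemma mem_order_ballI:
  "u \<in> K \<Longrightarrow> v \<in> order_ideal u \<Longrightarrow> gauge u v \<le> t \<Longrightarrow> v \<in> order_ball u t"
  using mem_order_ball_gauge order_ball_mono by blast

text \<open>\<open>Metric_space\<close> demands nonnegativity and symmetry at all points, even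
  outside the carrier; the default value 0 of \<open>gauge\<close> outside the ideal is compatible
  with both.\<close>

lemma Metric_space_order_ideal:
  assumes u: "u \<in> K"
  shows "Metric_space (order_ideal u) (\<lambda>v w. gauge u (v - w))"
proof
  fix v w assume vw: "v \<in> order_ideal u" "w \<in> order_ideal u"
  then have "v - w \<in> order_ball u (gauge u (v - w))"
    by (intro mem_order_ball_gauge order_ideal_diff)
  moreover have "gauge u 0 \<le> 0"
    by (rule gauge_le) (auto simp: order_ball_zero)
  ultimately show "gauge u (v - w) = 0 \<longleftrightarrow> v = w"
    using gauge_nonneg[of u 0] by (auto simp: order_ball_zero)
next
  fix v w x assume "v \<in> order_ideal u" "w \<in> order_ideal u" "x \<in> order_ideal u"
  then have "(v - w) + (w - x) \<in> order_ball u (gauge u (v - w) + gauge u (w - x))"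
    by (intro order_ball_add mem_order_ball_gauge order_ideal_diff)
  then have "gauge u ((v - w) + (w - x)) \<le> gauge u (v - w) + gauge u (w - x)"
    by (intro gauge_le add_nonneg_nonneg gauge_nonneg)
  then show "gauge u (v - x) \<le> gauge u (v - w) + gauge u (w - x)" by simp
qed (use gauge_nonneg gauge_uminus[of u "_ - _"] in \<open>auto simp: minus_diff_eq\<close>)

lemma mcomplete_order_ideal:
  assumes complete: "upper_self_complete K K" and u: "u \<in> K"
  shows "Metric_space.mcomplete (order_ideal u) (\<lambda>v w. gauge u (v - w))"
proof -
  interpret M: Metric_space "order_ideal u" "\<lambda>v w. gauge u (v - w)"
    by (rule Metric_space_order_ideal[OF u])
  show ?thesis
    unfolding M.mcomplete_def
  proof (intro allI impI)
    fix \<sigma> assume "M.MCauchy \<sigma>"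
    then have mem: "\<sigma> n \<in> order_ideal u"
      and "\<And>e. e > 0 \<Longrightarrow> \<exists>N. \<forall>m m'. N \<le> m \<longrightarrow> N \<le> m' \<longrightarrow> gauge u (\<sigma> m - \<sigma> m') < e" for n
      by (auto simp: M.MCauchy_def)
    then have "\<forall>k::nat. \<exists>N. \<forall>m m'. N \<le> m \<longrightarrow> N \<le> m' \<longrightarrow> gauge u (\<sigma> m - \<sigma> m') < 1 / 2 ^ k"
      by simp
    then obtain f where f: "\<And>k m m'. f k \<le> m \<Longrightarrow> f k \<le> m' \<Longrightarrow> gauge u (\<sigma> m - \<sigma> m') < 1 / 2 ^ k"
      by metis
    have close: "\<sigma> m - \<sigma> m' \<in> order_ball u (1 / 2 ^ k)" if "f k \<le> m" "f k \<le> m'" for k m m'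
      using f[OF that] mem by (intro mem_order_ballI[OF u] order_ideal_diff) auto
    \<comment> \<open>Partial sums give indices that are increasing and satisfy
      \<open>f n \<le> g n\<close>, although \<open>f\<close> need not be monotone.\<close>
    define g where "g n = (\<Sum>k\<le>n. f k)" for n
    have g: "f n \<le> g n" "g n \<le> g (Suc n)" for n
      unfolding g_def by (auto intro: member_le_sum)
    obtain t where t: "0 \<le> t" "\<sigma> (g 0) \<in> order_ball u t"
      using mem[of "g 0"] by (auto simp: order_ideal_def)
    have "\<exists>l. \<forall>n. l - \<sigma> (g n) \<in> order_ball u (2 / 2 ^ n)"
    proof (rule order_ball_Cauchy_limit[where v = "\<lambda>n. \<sigma> (g n)", OF complete u t(2)])
      show "\<sigma> (g (Suc n)) - \<sigma> (g n) \<in> order_ball u (1 / 2 ^ n)" for n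
        using g[of n] by (intro close) auto
    qed
    then obtain l where l: "\<And>n. l - \<sigma> (g n) \<in> order_ball u (2 / 2 ^ n)" by blast
    have "l - \<sigma> (g 0) \<in> order_ideal u"
      using l[of 0] order_ball_subset_ideal[of 2 u] by auto
    from order_ideal_add[OF this mem[of "g 0"]] have "l \<in> order_ideal u" by simp
    moreover have "\<exists>N. \<forall>m\<ge>N. gauge u (\<sigma> m - l) < e" if "e > 0" for e
    proof -
      \<comment> \<open>The error is \<open>1 / 2 ^ n\<close> from the Cauchy tail plus
        \<open>2 / 2 ^ n\<close> from the limit of the subsequence, hence the 3.\<close>
      obtain n where "(1/2) ^ n < e / 3"
        using real_arch_pow_inv[of "e / 3" "1/2"] \<open>e > 0\<close> by auto
      then have n: "1 / 2 ^ n + 2 / 2 ^ n < e" by (simp add: power_one_over field_simps)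
      have "gauge u (\<sigma> m - l) < e" if "m \<ge> f n" for m
      proof -
        have "(\<sigma> m - \<sigma> (g n)) - (l - \<sigma> (g n)) \<in> order_ball u (1 / 2 ^ n + 2 / 2 ^ n)"
          by (intro order_ball_diff l close that g)
        then have "gauge u (\<sigma> m - l) \<le> 1 / 2 ^ n + 2 / 2 ^ n"
          by (intro gauge_le) auto
        with n show ?thesis by linarith
      qed
      then show ?thesis by blast
    qed
    ultimately have "limitin M.mtopology \<sigma> l sequentially"
      using mem by (simp add: M.limitin_metric eventually_sequentially)
    then show "\<exists>l. limitin M.mtopology \<sigma> l sequentially" ..
  qed
qed

section \<open>Norm boundedness of order intervals by Baire category\<close>

text \<open>The ideal is the union of the gauge closures of its norm-bounded parts. By Baire, one
  closure contains a gauge ball about some \<open>a\<close>; symmetry then moves this ball to the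
  origin.\<close>

lemma order_ball_approximable:
  assumes complete: "upper_self_complete K K" and u: "u \<in> K"
  shows "\<exists>B r. r > 0 \<and> (\<forall>v\<in>order_ball u r. \<forall>e>0. \<exists>w. norm w \<le> B \<and> v - w \<in> order_ball u e)"
proof -
  interpret M: Metric_space "order_ideal u" "\<lambda>v w. gauge u (v - w)"
    by (rule Metric_space_order_ideal[OF u])
  define A where "A n = M.mtopology closure_of {v \<in> order_ideal u. norm v \<le> real n}" for n
  have "\<Union>(range A) = order_ideal u"
  proof
    show "\<Union>(range A) \<subseteq> order_ideal u"
      unfolding A_def using closure_of_subset_topspace[of M.mtopology] by (intro UN_least) simp
    show "order_ideal u \<subseteq> \<Union>(range A)"
    proof
      fix v assume v: "v \<in> order_ideal u"
      obtain n :: nat where "norm v \<le> real n" using real_arch_simple by blast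
      moreover have "{v \<in> order_ideal u. norm v \<le> real n} \<subseteq> A n"
        unfolding A_def by (rule closure_of_subset) auto
      ultimately have "v \<in> A n" using v by blast
      then show "v \<in> \<Union>(range A)" by blast
    qed
  qed
  moreover have "0 \<in> order_ideal u"
    using order_ball_zero[of 0 u] order_ball_subset_ideal[of 0 u] by auto
  ultimately have "M.mtopology interior_of \<Union>(range A) \<noteq> {}"
    using interior_of_topspace[of M.mtopology] by (metis M.topspace_mtopology empty_iff)
  moreover have "M.mtopology interior_of \<Union>(range A) = {}" if empty: "\<And>n. M.mtopology interior_of A n = {}"
  proof (rule M.metric_Baire_category_alt[OF mcomplete_order_ideal[OF complete u]])
    show "closedin M.mtopology T \<and> M.mtopology interior_of T = {}" if "T \<in> range A" for T
    proof -
      from that obtain n where T: "T = A n" by blast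
      then show ?thesis using empty[of n] closedin_closure_of unfolding T A_def by auto
    qed
  qed simp
  ultimately obtain n where "M.mtopology interior_of A n \<noteq> {}" by blast
  then obtain a where "a \<in> M.mtopology interior_of A n" by blast
  then obtain r where a: "a \<in> order_ideal u" and r: "r > 0" "M.mball a r \<subseteq> A n"
    unfolding M.in_interior_of_mball by blast
  \<comment> \<open>Radius \<open>r/2\<close> places the closed order ball inside the open gauge
    ball of radius \<open>r\<close>.\<close>
  have approx: "\<exists>w. norm w \<le> real n \<and> x - w \<in> order_ball u e"
    if x: "x - a \<in> order_ball u (r/2)" and "e > 0" for x e
  proof -
    have "x - a \<in> order_ideal u"
      using x r order_ball_subset_ideal[of "r/2" u] by auto
    from order_ideal_add[OF this a] have "x \<in> order_ideal u" by simp
    moreover have "gauge u (a - x) \<le> r/2"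
      using gauge_le[OF _ x] r gauge_uminus[of u "x - a"] by simp
    ultimately have "x \<in> M.mball a r" using a r(1) by simp
    then have "x \<in> A n" using r(2) by blast
    then obtain w where "w \<in> {v \<in> order_ideal u. norm v \<le> real n}" "w \<in> M.mball x e"
      using \<open>e > 0\<close> unfolding A_def M.metric_closure_of by blast
    then have w: "norm w \<le> real n" "x - w \<in> order_ideal u" "gauge u (x - w) \<le> e"
      by (auto intro: order_ideal_diff)
    from w(1) mem_order_ballI[OF u w(2,3)] show ?thesis by blast
  qed
  have "\<exists>w. norm w \<le> real n \<and> v - w \<in> order_ball u e" if v: "v \<in> order_ball u (r/2)" and "e > 0" for v e
  proof -
    \<comment> \<open>Half the difference of approximants to \<open>a + v\<close> and
      \<open>a - v\<close> approximates \<open>v\<close>: the centre cancels and the norm bound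
      survives.\<close>
    obtain w1 where w1: "norm w1 \<le> real n" "(a + v) - w1 \<in> order_ball u e"
      using approx[of "a + v" e] v \<open>e > 0\<close> by auto
    obtain w2 where w2: "norm w2 \<le> real n" "(a - v) - w2 \<in> order_ball u e"
      using approx[of "a - v" e] v \<open>e > 0\<close> by (auto simp: order_ball_uminus_iff)
    have "(1/2) *\<^sub>R (((a + v) - w1) - ((a - v) - w2)) \<in> order_ball u ((1/2) * (e + e))"
      by (intro order_ball_scale order_ball_diff w1 w2) simp
    moreover have "((a + v) - w1) - ((a - v) - w2) = 2 *\<^sub>R v - (w1 - w2)"
      by (simp add: scaleR_2)
    ultimately have "v - (1/2) *\<^sub>R (w1 - w2) \<in> order_ball u e"
      by (simp add: scaleR_diff_right)
    moreover have "norm ((1/2) *\<^sub>R (w1 - w2)) \<le> real n"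
      using norm_triangle_ineq4[of w1 w2] w1 w2 by simp
    ultimately show ?thesis by blast
  qed
  then show ?thesis using r(1) by (intro exI[of _ "real n"] exI[of _ "r/2"]) auto
qed

text \<open>Rescaling the approximation to radius \<open>(1/2) ^ k\<close> gives a correction of
  norm at most \<open>(B / r) * (1/2) ^ k\<close> that halves the radius of the remainder. Summing
  the corrections bounds \<open>v\<close> by \<open>(B / r) * 2\<close>.\<close>

lemma order_ball_bounded:
  assumes complete: "upper_self_complete K K" and u: "u \<in> K"
  shows "\<exists>B. \<forall>v\<in>order_ball u 1. norm v \<le> B"
proof -
  obtain B r where r: "r > 0"
    and Br: "\<And>v e. v \<in> order_ball u r \<Longrightarrow> e > 0 \<Longrightarrow> \<exists>w. norm w \<le> B \<and> v - w \<in> order_ball u e"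
    using order_ball_approximable[OF assms] by blast
  have approx: "\<exists>w. norm w \<le> (B / r) * (1/2) ^ k \<and> v - w \<in> order_ball u ((1/2) ^ Suc k)"
    if v: "v \<in> order_ball u ((1/2) ^ k)" for v and k :: nat
  proof -
    \<comment> \<open>Carries radius \<open>(1/2) ^ k\<close> to \<open>r\<close>; dividing by
      \<open>q\<close> afterwards scales both the error and the norm bound back.\<close>
    define q where "q = r / (1/2) ^ k"
    have q: "q > 0" "q * (1/2) ^ k = r" using r by (auto simp: q_def)
    obtain w where w: "norm w \<le> B" "q *\<^sub>R v - w \<in> order_ball u (q * (1/2) ^ Suc k)"
      using Br[of "q *\<^sub>R v" "q * (1/2) ^ Suc k"] order_ball_scale[OF _ v, of q] q by auto
    have eq: "(1/q) *\<^sub>R (q *\<^sub>R v - w) = v - (1/q) *\<^sub>R w" "(1/q) * (q * (1/2) ^ Suc k) = (1/2) ^ Suc k"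
      using q(1) by (simp_all add: scaleR_diff_right)
    have "v - (1/q) *\<^sub>R w \<in> order_ball u ((1/2) ^ Suc k)"
      using order_ball_scale[OF _ w(2), of "1/q", unfolded eq] q(1) by simp
    moreover have "norm ((1/q) *\<^sub>R w) \<le> (B / r) * (1/2) ^ k"
      using w(1) q r by (simp add: q_def field_simps)
    ultimately show ?thesis by blast
  qed
  then obtain W where W: "\<And>v k. v \<in> order_ball u ((1/2) ^ k) \<Longrightarrow> norm (W v k) \<le> (B / r) * (1/2) ^ k"
     "\<And>v k. v \<in> order_ball u ((1/2) ^ k) \<Longrightarrow> v - W v k \<in> order_ball u ((1/2) ^ Suc k)"
    by metis
  have "norm v \<le> (B / r) * 2" if v: "v \<in> order_ball u 1" for v
  proof -
    \<comment> \<open>Successive approximation: \<open>v\<close> is the sum of the \<open>w k\<close> in the order-unit norm, and hence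
      also in norm, as the norm limit of order-ball members stays in the order ball.\<close>
    define rest where "rest = rec_nat v (\<lambda>k x. x - W x k)"
    have rest_simps: "rest 0 = v" "rest (Suc k) = rest k - W (rest k) k" for k
      by (simp_all add: rest_def)
    have rest: "rest k \<in> order_ball u ((1/2) ^ k)" for k
      by (induction k) (use v W(2) in \<open>simp_all only: rest_simps power_0\<close>)
    define w where "w k = W (rest k) k" for k
    have norm_w: "norm (w k) \<le> (B / r) * (1/2) ^ k" for k
      unfolding w_def by (rule W(1)[OF rest])
    have sum_w: "(\<Sum>i<k. w i) = v - rest k" for k
      by (induction k) (simp_all add: rest_simps w_def)
    have geometric: "(\<lambda>k. (B / r) * (1/2) ^ k) sums ((B / r) * 2)"
      using sums_mult[OF geometric_sums[of "1/2::real"], of "B / r"] by simp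
    have summable: "summable w"
      using summable_comparison_test'[OF sums_summable[OF geometric]] norm_w by blast
    then have "(\<lambda>k. v - (\<Sum>i<k. w i)) \<longlonglongrightarrow> v - suminf w"
      by (intro tendsto_diff tendsto_const summable_LIMSEQ)
    then have "rest \<longlonglongrightarrow> v - suminf w" by (simp add: sum_w)
    moreover have "(\<lambda>k. (1/2::real) ^ k) \<longlonglongrightarrow> 0"
      by (intro LIMSEQ_power_zero) simp
    ultimately have "v - suminf w \<in> order_ball u 0"
      using order_ball_limit rest by blast
    then have "v = suminf w" by (simp add: order_ball_zero)
    moreover have "norm (suminf w) \<le> (\<Sum>k. (B / r) * (1/2) ^ k)"
      by (rule norm_suminf_le) (use geometric norm_w in \<open>auto simp: sums_iff\<close>)
    ultimately show ?thesis using geometric by (simp add: sums_iff)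
  qed
  then show ?thesis by blast
qed

lemma normal_of_upper_self_complete:
  assumes "upper_self_complete K K"
  shows "normal_cone K"
proof (rule normal_of_bounded_intervals)
  fix u assume u: "u \<in> K"
  obtain B where B: "\<And>v. v \<in> order_ball u 1 \<Longrightarrow> norm v \<le> B"
    using order_ball_bounded[OF assms u] by blast
  have "y \<in> order_ball u 1" if "0 \<preceq> y" "y \<preceq> u" for y
    using that add_mem[OF u, of y] by (simp add: order_ball_def cone_le_def)
  then show "\<exists>B. \<forall>y. 0 \<preceq> y \<and> y \<preceq> u \<longrightarrow> norm y \<le> B" using B by blast
qed

end

theorem theorem4p20:
  fixes K :: "'a::banach set"
  assumes "ordering_cone K"
    and "closed K"
  shows "(thompson_complete K K \<longleftrightarrow> (\<forall>C\<in>components_of_cone K. thompson_complete K C)) \<and>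
    (thompson_complete K K \<longleftrightarrow> self_complete K K) \<and>
    (self_complete K K \<longleftrightarrow> normal_cone K) \<and>
    (normal_cone K \<longleftrightarrow>
       (\<forall>U. openin (top_of_set K) U \<longrightarrow> openin (thompson_topology K) U))"
proof -
  interpret closed_cone K using assms by unfold_locales
  \<comment> \<open>Completeness, self-completeness and normality form a cycle; the component and
    topology statements are attached to it separately.\<close>
  have "thompson_complete K K \<Longrightarrow> self_complete K K"
    by (rule self_complete_of_complete)
  moreover have "self_complete K K \<Longrightarrow> normal_cone K"
    by (simp add: self_complete_def normal_of_upper_self_complete)
  moreover have "normal_cone K \<Longrightarrow> thompson_complete K K"
    by (rule complete_of_normal)
  ultimately show ?thesis
    using complete_iff_components_complete thompson_topology_finer_of_normal
      normal_of_thompson_topology_finer by blast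
qed

end
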